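(* Let $K\ge2$ and fix $k\in\{1,\dots,K\}$. Let $f(p)=\frac Kk\mathbf 1\{p\in(0,k/K]\}+\infty\,\mathbf 1\{p=0\}$ for $p\in[0,\infty)$, and define $F_{\mathrm{ER}}:[0,1]^K\to[0,1]$ by $$F_{\mathrm{ER}}(\mathbf p)=\inf\left\{\alpha\in(0,1):\ \bigvee_{\ell\le K}\left(\frac1\ell\sum_{i=1}^\ell f\left(\frac{p_i}{\alpha}\right)\right)\ge1\right\},\qquad\inf\varnothing=1 .$$ Then for all $\mathbf p\in[0,1]^K$, $$F_{\mathrm{ER}}(\mathbf p)=\min\left\{1,\ \left(\frac Kk\bigwedge_{\ell=1}^K p^{\ell}_{(\lambda_\ell)}\right)\mathbf 1\{p_{(1)}>0\}\right\},\qquad \lambda_\ell:=\left\lceil \ell\,\tfrac kK\right\rceil ,$$ and $F_{\mathrm{ER}}$ is an ex-p-merging function that strictly dominates the function $F_{\mathrm R}(\mathbf p)=\frac Kk\,p_{(k)}$ on $[0,1]^K$.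
   Context: $\bigvee,\bigwedge$ denote maximum and minimum; $\infty\cdot 0=0$ in the definition of $f$ (so $f(0)=\infty$ and $f(p)<\infty$ for $p>0$). $p_{(j)}$ is the $j$-th smallest value among $p_1,\dots,p_K$, and $p^\ell_{(j)}$ is the $j$-th smallest value among $p_1,\dots,p_\ell$. Fix an atomless probability space; $\mathcal U^K$ is the set of all $K$-dimensional random vectors (arbitrary joint distribution) with components uniform on $[0,1]$; a vector is exchangeable if its law is invariant under permutations of components. An ex-p-merging function is an increasing (non-decreasing in each component) Borel function $F:[0,1]^K\to[0,1]$ with $\mathbb P(F(\mathbf P)\le\alpha)\le\alpha$ for all $\alpha\in(0,1)$ and all exchangeable $\mathbf P\in\mathcal U^K$. $F$ strictly dominates $G$ if $F(\mathbf p)\le G(\mathbf p)$ for all $\mathbf p$ and $F(\mathbf p)<G(\mathbf p)$ for at least one $\mathbf p$. *)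

theory Defs
  imports "HOL-Probability.Probability" "HOL-Combinatorics.Permutations"
begin

text \<open>
  Vectors in \<open>[0,1]\<^sup>K\<close> are extensional functions on \<open>{1..K}\<close>, indexed from 1.  Since the reals
  are second countable, the product \<open>\<sigma>\<close>-algebra of \<open>borel_cube\<close> is the Borel \<open>\<sigma>\<close>-algebra of
  the cube.
\<close>

definition unit_cube :: "nat \<Rightarrow> (nat \<Rightarrow> real) set" where
  "unit_cube K = {1..K} \<rightarrow>\<^sub>E {0..1}"

definition borel_cube :: "nat \<Rightarrow> (nat \<Rightarrow> real) measure" where
  "borel_cube K = PiM {1..K} (\<lambda>_. restrict_space borel {0..1})"

lemma space_borel_cube: "space (borel_cube K) = unit_cube K"
  by (simp add: borel_cube_def unit_cube_def space_PiM space_restrict_space)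

definition atomless :: "'a measure \<Rightarrow> bool" where
  "atomless M \<longleftrightarrow> (\<forall>A\<in>sets M. emeasure M A > 0 \<longrightarrow>
     (\<exists>B\<in>sets M. B \<subseteq> A \<and> 0 < emeasure M B \<and> emeasure M B < emeasure M A))"

text \<open>
  The components take values in \<open>[0,1]\<close> everywhere, not only almost surely, so that a function
  on the cube can be applied to the vector.
\<close>

definition uniform_vectors :: "'a measure \<Rightarrow> nat \<Rightarrow> ('a \<Rightarrow> nat \<Rightarrow> real) set" where
  "uniform_vectors M K = {P \<in> measurable M (borel_cube K).
     \<forall>i\<in>{1..K}. distr M borel (\<lambda>\<omega>. P \<omega> i) = uniform_measure lborel {0..1}}"

definition exchangeable :: "'a measure \<Rightarrow> nat \<Rightarrow> ('a \<Rightarrow> nat \<Rightarrow> real) \<Rightarrow> bool" where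
  "exchangeable M K P \<longleftrightarrow> (\<forall>\<pi>. \<pi> permutes {1..K} \<longrightarrow>
     distr M (borel_cube K) (\<lambda>\<omega>. \<lambda>i\<in>{1..K}. P \<omega> (\<pi> i)) = distr M (borel_cube K) P)"

definition ex_p_merging :: "'a measure \<Rightarrow> nat \<Rightarrow> ((nat \<Rightarrow> real) \<Rightarrow> real) \<Rightarrow> bool" where
  "ex_p_merging M K F \<longleftrightarrow>
     (\<forall>p\<in>unit_cube K. F p \<in> {0..1}) \<and>
     (\<forall>p\<in>unit_cube K. \<forall>q\<in>unit_cube K. (\<forall>i\<in>{1..K}. p i \<le> q i) \<longrightarrow> F p \<le> F q) \<and>
     F \<in> borel_measurable (borel_cube K) \<and>
     (\<forall>P\<in>uniform_vectors M K. exchangeable M K P \<longrightarrow>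
        (\<forall>\<alpha>\<in>{0<..<1}. measure M {\<omega> \<in> space M. F (P \<omega>) \<le> \<alpha>} \<le> \<alpha>))"

definition strictly_dominates ::
    "nat \<Rightarrow> ((nat \<Rightarrow> real) \<Rightarrow> real) \<Rightarrow> ((nat \<Rightarrow> real) \<Rightarrow> real) \<Rightarrow> bool" where
  "strictly_dominates K F G \<longleftrightarrow>
     (\<forall>p\<in>unit_cube K. F p \<le> G p) \<and> (\<exists>p\<in>unit_cube K. F p < G p)"

text \<open>
  \<open>order_stat p l j\<close> is the \<open>j\<close>-th smallest (with multiplicity) of \<open>p 1, \<dots>, p l\<close>; it is
  meaningful for \<open>1 \<le> j \<le> l\<close>.
\<close>

definition order_stat :: "(nat \<Rightarrow> real) \<Rightarrow> nat \<Rightarrow> nat \<Rightarrow> real" where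
  "order_stat p l j = sort (map p [1..<Suc l]) ! (j - 1)"

text \<open>In \<^typ>\<open>ennreal\<close>, \<open>\<infinity> * 0 = 0\<close>, as needed here.\<close>

definition calib :: "nat \<Rightarrow> nat \<Rightarrow> real \<Rightarrow> ennreal" where
  "calib K k x = ennreal (real K / real k) * indicator {0<..real k / real K} x + \<infinity> * indicator {0} x"

definition ER_level_set :: "nat \<Rightarrow> nat \<Rightarrow> (nat \<Rightarrow> real) \<Rightarrow> real set" where
  "ER_level_set K k p = {\<alpha> \<in> {0<..<1}.
     Max ((\<lambda>l. ennreal (1 / real l) * (\<Sum>i=1..l. calib K k (p i / \<alpha>))) ` {1..K}) \<ge> 1}"

definition F_ER :: "nat \<Rightarrow> nat \<Rightarrow> (nat \<Rightarrow> real) \<Rightarrow> real" where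
  "F_ER K k p = (if ER_level_set K k p = {} then 1 else Inf (ER_level_set K k p))"

definition F_R :: "nat \<Rightarrow> nat \<Rightarrow> (nat \<Rightarrow> real) \<Rightarrow> real" where
  "F_R K k p = real K / real k * order_stat p K k"

end

theory Submission
  imports Defs
begin

text \<open>
  For strictly positive \<open>p\<close>, the mean over the first \<open>l\<close> components reaches 1 at level \<open>\<alpha>\<close> iff
  at least \<open>l k / K\<close> of them are at most \<open>\<alpha> k / K\<close>, that is, iff the corresponding order
  statistic is; a zero component makes every level admissible.

  Validity is Markov's inequality made uniform over \<open>l\<close> by exchangeability.  Split the event that
  some partial sum \<open>S\<^sub>l\<close> reaches \<open>l c\<close> according to the last such \<open>l\<close>.  The event \<open>A\<^sub>l\<close> that this
  index is \<open>l\<close> involves only \<open>S\<^sub>l, \<dots>, S\<^sub>K\<close>, hence is invariant under permutations of the first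
  \<open>l\<close> components, so \<open>E[X\<^sub>1; A\<^sub>l] = E[S\<^sub>l / l; A\<^sub>l] \<ge> c P(A\<^sub>l)\<close>; now sum over \<open>l\<close>.
\<close>

section \<open>Order statistics as counting conditions\<close>

text \<open>In a sorted list the entries bounded by \<open>x\<close> form an initial segment, so
  position \<open>j - 1\<close> (lists count from 0) belongs to it exactly when the segment has
  length at least \<open>j\<close>. Filtering commutes with sorting, which turns that length into a
  count of indices of \<open>p\<close>.\<close>

lemma order_stat_le_iff:
  assumes "1 \<le> j" "j \<le> l"
  shows "order_stat p l j \<le> x \<longleftrightarrow> j \<le> card {i\<in>{1..l}. p i \<le> x}"
proof -
  define xs where "xs = sort (map p [1..<Suc l])"
  have srt: "sorted xs" and len: "length xs = l"
    by (simp_all add: xs_def del: upt_Suc)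
  have "card {i. i < length xs \<and> xs ! i \<le> x} = length (filter (\<lambda>y. y \<le> x) xs)"
    by (simp add: length_filter_conv_card)
  also have "\<dots> = length (filter (\<lambda>i. p i \<le> x) [1..<Suc l])"
    by (simp add: xs_def filter_sort filter_map o_def del: upt_Suc)
  also have "\<dots> = card {i\<in>{1..l}. p i \<le> x}"
    by (subst distinct_length_filter) (auto intro!: arg_cong[where f = card] simp del: upt_Suc)
  finally have card_eq: "card {i\<in>{1..l}. p i \<le> x} = card {i. i < l \<and> xs ! i \<le> x}"
    by (simp add: len)
  have "xs ! (j - 1) \<le> x \<longleftrightarrow> j \<le> card {i. i < l \<and> xs ! i \<le> x}"
  proof
    assume le: "xs ! (j - 1) \<le> x"
    have "{..<j} \<subseteq> {i. i < l \<and> xs ! i \<le> x}"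
    proof
      fix i assume "i \<in> {..<j}"
      then have "i \<le> j - 1" "j - 1 < length xs" "i < l" using assms len by auto
      then show "i \<in> {i. i < l \<and> xs ! i \<le> x}"
        using sorted_nth_mono[OF srt, of i "j - 1"] le by auto
    qed
    then have "card {..<j} \<le> card {i. i < l \<and> xs ! i \<le> x}" by (intro card_mono) auto
    then show "j \<le> card {i. i < l \<and> xs ! i \<le> x}" by simp
  next
    assume le: "j \<le> card {i. i < l \<and> xs ! i \<le> x}"
    show "xs ! (j - 1) \<le> x"
    proof (rule ccontr)
      assume gt: "\<not> xs ! (j - 1) \<le> x"
      \<comment> \<open>From position \<open>j - 1\<close> on, every entry exceeds \<open>x\<close>,
        so at most \<open>j - 1\<close> entries are bounded by \<open>x\<close>.\<close>
      have "{i. i < l \<and> xs ! i \<le> x} \<subseteq> {..<j - 1}"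
      proof
        fix i assume i: "i \<in> {i. i < l \<and> xs ! i \<le> x}"
        show "i \<in> {..<j - 1}"
        proof (rule ccontr)
          assume "i \<notin> {..<j - 1}"
          then have "xs ! (j - 1) \<le> xs ! i" using sorted_nth_mono[OF srt, of "j - 1" i] i len by auto
          then show False using gt i by simp
        qed
      qed
      then have "card {i. i < l \<and> xs ! i \<le> x} \<le> card {..<j - 1}" by (intro card_mono) auto
      then show False using le assms by simp
    qed
  qed
  then show ?thesis unfolding order_stat_def card_eq xs_def[symmetric] .
qed

lemma order_stat_pos_iff:
  assumes "1 \<le> j" "j \<le> l"
  shows "0 < order_stat p l j \<longleftrightarrow> card {i\<in>{1..l}. p i \<le> 0} < j"
  using order_stat_le_iff[OF assms, of p 0] by auto

section \<open>The calibrator and the level sets\<close>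

text \<open>Away from 0 the infinite term vanishes, so sums of calibrator values can be computed
  among the reals.\<close>

lemma calib_eq:
  assumes "0 < x"
  shows "calib K k x = ennreal (real K / real k * of_bool (x \<le> real k / real K))"
  using assms by (auto simp: calib_def indicator_def)

lemma calib_zero: "calib K k 0 = \<infinity>"
  by (simp add: calib_def)

lemma calib_antimono:
  assumes "0 \<le> x" "x \<le> y"
  shows "calib K k y \<le> calib K k x"
proof (cases "x = 0")
  case False
  with assms show ?thesis by (auto simp: calib_eq intro!: ennreal_leI)
qed (simp add: calib_zero)

lemma measurable_calib [measurable]: "calib K k \<in> borel_measurable borel"
  unfolding calib_def[abs_def] by measurable

text \<open>Multiplication by \<open>l\<close> preserves and reflects the order of
  \<open>ennreal\<close> because \<open>l\<close> is neither 0 nor infinite. Clearing the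
  denominator gives the form that the maximal inequality uses.\<close>

lemma one_le_ennreal_mean_iff:
  assumes "l \<ge> 1"
  shows "1 \<le> ennreal (1 / real l) * s \<longleftrightarrow> of_nat l \<le> s"
proof -
  have "1 \<le> ennreal (1 / real l) * s \<longleftrightarrow> of_nat l * 1 \<le> of_nat l * (ennreal (1 / real l) * s)"
    using assms by (subst ennreal_mult_le_mult_iff) (auto simp: ennreal_of_nat_eq_real_of_nat)
  also have "of_nat l * (ennreal (1 / real l) * s) = s"
    using assms
    by (simp add: ennreal_of_nat_eq_real_of_nat mult.assoc[symmetric] ennreal_mult[symmetric])
  finally show ?thesis by simp
qed

lemma mem_ER_level_set_iff:
  assumes "K \<ge> 1"
  shows "\<alpha> \<in> ER_level_set K k p \<longleftrightarrow>
    \<alpha> \<in> {0<..<1} \<and> (\<exists>l\<in>{1..K}. of_nat l \<le> (\<Sum>i=1..l. calib K k (p i / \<alpha>)))"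
proof -
  have "1 \<le> Max ((\<lambda>l. ennreal (1 / real l) * (\<Sum>i=1..l. calib K k (p i / \<alpha>))) ` {1..K}) \<longleftrightarrow>
    (\<exists>l\<in>{1..K}. of_nat l \<le> (\<Sum>i=1..l. calib K k (p i / \<alpha>)))"
    using assms by (subst Max_ge_iff) (auto simp: one_le_ennreal_mean_iff)
  then show ?thesis by (auto simp: ER_level_set_def)
qed

section \<open>The closed formula\<close>

text \<open>The formula before truncation at 1 and before the correction for zero components. At (1,
  0) with K = k = 2 it equals 1 although \<open>F_ER\<close> is 0, which is why the indicator factor
  appears in the final formula.\<close>

definition ER_threshold :: "nat \<Rightarrow> nat \<Rightarrow> (nat \<Rightarrow> real) \<Rightarrow> real" where
  "ER_threshold K k p = real K / real k *
     Min ((\<lambda>l. order_stat p l (nat \<lceil>real l * (real k / real K)\<rceil>)) ` {1..K})"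

lemma rank_bounds:
  assumes "k \<in> {1..K}" "l \<in> {1..K}"
  shows "1 \<le> nat \<lceil>real l * (real k / real K)\<rceil>" "nat \<lceil>real l * (real k / real K)\<rceil> \<le> l"
proof -
  have "0 < real l * (real k / real K)" using assms by auto
  then show "1 \<le> nat \<lceil>real l * (real k / real K)\<rceil>" by linarith
  have "real l * (real k / real K) \<le> real l * 1" using assms by (intro mult_left_mono) auto
  then show "nat \<lceil>real l * (real k / real K)\<rceil> \<le> l" by linarith
qed

lemma ER_threshold_le_iff:
  assumes k: "k \<in> {1..K}"
  shows "ER_threshold K k p \<le> \<alpha> \<longleftrightarrow>
    (\<exists>l\<in>{1..K}. real l * (real k / real K) \<le> card {i\<in>{1..l}. p i \<le> \<alpha> * (real k / real K)})"
proof -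
  have "ER_threshold K k p \<le> \<alpha> \<longleftrightarrow>
    Min ((\<lambda>l. order_stat p l (nat \<lceil>real l * (real k / real K)\<rceil>)) ` {1..K}) \<le> \<alpha> * (real k / real K)"
    using k by (simp add: ER_threshold_def field_simps)
  also have "\<dots> \<longleftrightarrow> (\<exists>l\<in>{1..K}. nat \<lceil>real l * (real k / real K)\<rceil>
      \<le> card {i\<in>{1..l}. p i \<le> \<alpha> * (real k / real K)})"
    using k rank_bounds[OF k]
    by (subst Min_le_iff) (auto simp: order_stat_le_iff)
  also have "\<dots> \<longleftrightarrow> (\<exists>l\<in>{1..K}. real l * (real k / real K)
      \<le> card {i\<in>{1..l}. p i \<le> \<alpha> * (real k / real K)})"
    by (intro bex_cong refl) linarith
  finally show ?thesis .
qed

text \<open>With no zero component each partial sum is K/k times the number of components at most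
  \<alpha> k/K, and this is the counting condition of \<open>ER_threshold_le_iff\<close>.\<close>

lemma mem_ER_level_set_iff_threshold:
  assumes k: "k \<in> {1..K}" and pos: "\<And>i. i \<in> {1..K} \<Longrightarrow> 0 < p i"
  shows "\<alpha> \<in> ER_level_set K k p \<longleftrightarrow> \<alpha> \<in> {0<..<1} \<and> ER_threshold K k p \<le> \<alpha>"
proof -
  have "of_nat l \<le> (\<Sum>i=1..l. calib K k (p i / \<alpha>)) \<longleftrightarrow>
      real l * (real k / real K) \<le> card {i\<in>{1..l}. p i \<le> \<alpha> * (real k / real K)}"
    if \<alpha>: "\<alpha> \<in> {0<..<1}" and l: "l \<in> {1..K}" for l
  proof -
    have "(\<Sum>i=1..l. calib K k (p i / \<alpha>)) =
        (\<Sum>i=1..l. ennreal (real K / real k * of_bool (p i \<le> \<alpha> * (real k / real K))))"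
    proof (intro sum.cong refl)
      fix i assume "i \<in> {1..l}"
      then have "0 < p i / \<alpha>" using pos[of i] l \<alpha> by auto
      moreover have "p i / \<alpha> \<le> real k / real K \<longleftrightarrow> p i \<le> \<alpha> * (real k / real K)"
        using \<alpha> by (auto simp: pos_divide_le_eq mult.commute)
      ultimately show "calib K k (p i / \<alpha>) =
          ennreal (real K / real k * of_bool (p i \<le> \<alpha> * (real k / real K)))"
        by (simp add: calib_eq)
    qed
    also have "\<dots> = ennreal (\<Sum>i=1..l. real K / real k * of_bool (p i \<le> \<alpha> * (real k / real K)))"
      by (intro sum_ennreal) simp
    also have "(\<Sum>i=1..l. real K / real k * of_bool (p i \<le> \<alpha> * (real k / real K))) =
        real K / real k * card {i\<in>{1..l}. p i \<le> \<alpha> * (real k / real K)}"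
      by (subst sum_distrib_left[symmetric], subst sum_of_bool_eq) (simp_all add: Int_def)
    finally have "of_nat l \<le> (\<Sum>i=1..l. calib K k (p i / \<alpha>)) \<longleftrightarrow>
        real l \<le> real K / real k * card {i\<in>{1..l}. p i \<le> \<alpha> * (real k / real K)}"
      by (simp add: ennreal_of_nat_eq_real_of_nat)
    then show ?thesis using k by (simp add: field_simps)
  qed
  then show ?thesis
    using k unfolding ER_threshold_le_iff[OF k] by (subst mem_ER_level_set_iff) (simp, blast)
qed

text \<open>One summand is infinite at every level. Taking \<open>l = K\<close> makes sure that the
  partial sum includes index \<open>j\<close>.\<close>

lemma ER_level_set_of_zero:
  assumes "j \<in> {1..K}" "p j = 0"
  shows "ER_level_set K k p = {0<..<1}"
proof -
  have "of_nat K \<le> (\<Sum>i=1..K. calib K k (p i / \<alpha>))" for \<alpha>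
  proof -
    have "calib K k (p j / \<alpha>) \<le> (\<Sum>i=1..K. calib K k (p i / \<alpha>))"
      using assms by (intro member_le_sum) auto
    then have "(\<Sum>i=1..K. calib K k (p i / \<alpha>)) = \<top>"
      unfolding assms(2) by (simp only: div_0 calib_zero infinity_ennreal_def top_unique)
    then show ?thesis by (simp only: top_greatest)
  qed
  then show ?thesis using assms
    by (auto simp: mem_ER_level_set_iff intro!: bexI[of _ K])
qed

lemma order_stat_one_pos_iff:
  assumes "K \<ge> 1"
  shows "0 < order_stat p K 1 \<longleftrightarrow> (\<forall>i\<in>{1..K}. 0 < p i)"
proof -
  have "0 < order_stat p K 1 \<longleftrightarrow> {i\<in>{1..K}. p i \<le> 0} = {}"
    using assms by (subst order_stat_pos_iff) auto
  also have "\<dots> \<longleftrightarrow> (\<forall>i\<in>{1..K}. 0 < p i)" unfolding not_le[symmetric] by blast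
  finally show ?thesis .
qed

text \<open>At level 0 no positive component is counted, while the required count l k/K is
  positive.\<close>

lemma ER_threshold_pos:
  assumes k: "k \<in> {1..K}" and pos: "\<And>i. i \<in> {1..K} \<Longrightarrow> 0 < p i"
  shows "0 < ER_threshold K k p"
proof (rule ccontr)
  assume "\<not> 0 < ER_threshold K k p"
  then have "ER_threshold K k p \<le> 0" by simp
  then obtain l where l: "l \<in> {1..K}"
      and le: "real l * (real k / real K) \<le> card {i\<in>{1..l}. p i \<le> 0 * (real k / real K)}"
    using k by (subst (asm) ER_threshold_le_iff) auto
  have none: "{i\<in>{1..l}. p i \<le> 0 * (real k / real K)} = {}" using pos l by force
  have "0 < real l * (real k / real K)" using k l by auto
  with le show False unfolding none by simp
qed

lemma F_ER_eq:
  assumes k: "k \<in> {1..K}" and p: "p \<in> unit_cube K"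
  shows "F_ER K k p = min 1 (ER_threshold K k p * of_bool (0 < order_stat p K 1))"
proof (cases "\<forall>i\<in>{1..K}. 0 < p i")
  case True
  have eq: "ER_level_set K k p = {0<..<1} \<inter> {ER_threshold K k p..}"
    using mem_ER_level_set_iff_threshold[OF k] True by auto
  have pos: "0 < ER_threshold K k p" using ER_threshold_pos[OF k] True by auto
  have "F_ER K k p = min 1 (ER_threshold K k p)"
  proof (cases "ER_threshold K k p < 1")
    case lt: True
    \<comment> \<open>Since the threshold is positive, the constraint 0 < \<alpha> is implied; the
      level set contains its left end, which is the infimum.\<close>
    then have "ER_level_set K k p = {ER_threshold K k p..<1}"
      using eq pos unfolding set_eq_iff Int_iff greaterThanLessThan_iff atLeast_iff atLeastLessThan_iff
      by (meson less_le_trans)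
    then show ?thesis using lt by (simp add: F_ER_def)
  next
    case False
    \<comment> \<open>No level below 1 is admissible, and the default value 1 agrees with the
      truncation.\<close>
    then have "ER_level_set K k p = {}"
      unfolding eq by (simp add: disjoint_iff)
    then show ?thesis using False by (simp add: F_ER_def)
  qed
  moreover have "0 < order_stat p K 1" using True k by (subst order_stat_one_pos_iff) auto
  ultimately show ?thesis by (simp only: of_bool_eq mult_1_right)
next
  case False
  then obtain j where "j \<in> {1..K}" "p j = 0"
    using p by (force simp: unit_cube_def PiE_iff)
  then have "F_ER K k p = 0" by (simp add: F_ER_def ER_level_set_of_zero)
  moreover have "\<not> 0 < order_stat p K 1" using False k by (subst order_stat_one_pos_iff) auto
  ultimately show ?thesis by simp
qed

section \<open>Sublevel events, range and monotonicity\<close>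

text \<open>For positive \<open>p\<close> the infimum of a nonempty level set is attained and all
  larger levels below 1 are admissible. With a zero component the infimum 0 is not attained, but
  every level in (0,1) is admissible, so the equivalence survives.\<close>

lemma F_ER_le_iff:
  assumes k: "k \<in> {1..K}" and p: "p \<in> unit_cube K" and \<alpha>: "0 < \<alpha>" "\<alpha> < 1"
  shows "F_ER K k p \<le> \<alpha> \<longleftrightarrow> \<alpha> \<in> ER_level_set K k p"
proof (cases "\<forall>i\<in>{1..K}. 0 < p i")
  case True
  then show ?thesis
    using k \<alpha> order_stat_one_pos_iff[of K p] mem_ER_level_set_iff_threshold[OF k, of p \<alpha>]
    by (simp add: F_ER_eq[OF k p] min_le_iff_disj)
next
  case False
  then obtain j where "j \<in> {1..K}" "p j = 0"
    using p by (force simp: unit_cube_def PiE_iff)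
  then show ?thesis using \<alpha>
    by (simp add: F_ER_def ER_level_set_of_zero)
qed

lemma F_ER_range:
  assumes k: "k \<in> {1..K}" and p: "p \<in> unit_cube K"
  shows "F_ER K k p \<in> {0..1}"
proof -
  have "0 \<le> ER_threshold K k p * of_bool (0 < order_stat p K 1)"
    using ER_threshold_pos[OF k, of p] k order_stat_one_pos_iff[of K p]
    by (cases "0 < order_stat p K 1") (auto simp: less_imp_le)
  then show ?thesis by (simp add: F_ER_eq[OF k p])
qed

text \<open>The calibrator is decreasing, so smaller components enlarge the level set and lower its
  infimum. If the level set of \<open>q\<close> is empty, its value is 1 and the range bound
  suffices.\<close>

lemma F_ER_mono:
  assumes k: "k \<in> {1..K}" and p: "p \<in> unit_cube K" and q: "q \<in> unit_cube K"
    and le: "\<And>i. i \<in> {1..K} \<Longrightarrow> p i \<le> q i"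
  shows "F_ER K k p \<le> F_ER K k q"
proof -
  have sub: "ER_level_set K k q \<subseteq> ER_level_set K k p"
  proof
    fix \<alpha> assume "\<alpha> \<in> ER_level_set K k q"
    then obtain l where \<alpha>: "\<alpha> \<in> {0<..<1}" and l: "l \<in> {1..K}"
      and *: "of_nat l \<le> (\<Sum>i=1..l. calib K k (q i / \<alpha>))"
      using k by (auto simp: mem_ER_level_set_iff)
    have "(\<Sum>i=1..l. calib K k (q i / \<alpha>)) \<le> (\<Sum>i=1..l. calib K k (p i / \<alpha>))"
      using p le l \<alpha>
      by (intro sum_mono calib_antimono) (auto simp: unit_cube_def PiE_iff intro!: divide_right_mono)
    with * \<alpha> l show "\<alpha> \<in> ER_level_set K k p"
      using k by (auto simp: mem_ER_level_set_iff intro: order_trans)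
  qed
  show ?thesis
  proof (cases "ER_level_set K k q = {}")
    case True
    then show ?thesis using F_ER_range[OF k p] by (simp add: F_ER_def)
  next
    case False
    have "bdd_below (ER_level_set K k p)"
      by (rule bdd_belowI[of _ 0]) (auto simp: ER_level_set_def)
    with False sub show ?thesis by (auto simp: F_ER_def intro!: cInf_superset_mono)
  qed
qed

section \<open>Borel measurability\<close>

lemma borel_cube_component [measurable]:
  "i \<in> {1..K} \<Longrightarrow> (\<lambda>p. p i) \<in> borel_measurable (borel_cube K)"
  unfolding borel_cube_def
  by (rule measurable_compose[OF measurable_component_singleton])
     (auto intro: measurable_restrict_space1)

text \<open>Admissibility of one fixed level is a finite disjunction of measurable conditions. The
  infimum is reduced to countably many levels by inserting a rational between
  \<open>F_ER K k p\<close> and \<open>a\<close>.\<close>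

lemma F_ER_measurable:
  assumes k: "k \<in> {1..K}"
  shows "F_ER K k \<in> borel_measurable (borel_cube K)"
  unfolding borel_measurable_iff_less
proof
  fix a :: real
  have level: "{p \<in> space (borel_cube K). \<alpha> \<in> ER_level_set K k p} \<in> sets (borel_cube K)" for \<alpha>
  proof -
    have [measurable]: "(\<lambda>p. \<Sum>i=1..l. calib K k (p i / \<alpha>)) \<in> borel_measurable (borel_cube K)"
      if "l \<in> {1..K}" for l
    proof (rule borel_measurable_sum)
      fix i assume "i \<in> {1..l}"
      then have [measurable]: "(\<lambda>p. p i) \<in> borel_measurable (borel_cube K)"
        using that by (intro borel_cube_component) auto
      show "(\<lambda>p. calib K k (p i / \<alpha>)) \<in> borel_measurable (borel_cube K)" by measurable
    qed
    have "{p \<in> space (borel_cube K). \<alpha> \<in> {0<..<1} \<and>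
        (\<exists>l\<in>{1..K}. of_nat l \<le> (\<Sum>i=1..l. calib K k (p i / \<alpha>)))} \<in> sets (borel_cube K)"
      by measurable
    then show ?thesis using k by (simp add: mem_ER_level_set_iff)
  qed
  show "{p \<in> space (borel_cube K). F_ER K k p < a} \<in> sets (borel_cube K)"
  proof (cases "a \<le> 1")
    \<comment> \<open>The bound \<open>a \<le> 1\<close> keeps the rationals below \<open>a\<close>
      inside (0,1), where \<open>F_ER_le_iff\<close> applies.\<close>
    case True
    have "F_ER K k p < a \<longleftrightarrow> (\<exists>q\<in>\<rat> \<inter> {0<..<a}. q \<in> ER_level_set K k p)"
      if p: "p \<in> unit_cube K" for p
    proof
      assume lt: "F_ER K k p < a"
      obtain q where q: "q \<in> \<rat>" "F_ER K k p < q" "q < a" using Rats_dense_in_real[OF lt] by auto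
      then show "\<exists>q\<in>\<rat> \<inter> {0<..<a}. q \<in> ER_level_set K k p"
        using F_ER_range[OF k p] F_ER_le_iff[OF k p, of q] True by (intro bexI[of _ q]) auto
    next
      assume "\<exists>q\<in>\<rat> \<inter> {0<..<a}. q \<in> ER_level_set K k p"
      then obtain q where "q \<in> {0<..<a}" "q \<in> ER_level_set K k p" by auto
      then show "F_ER K k p < a" using True F_ER_le_iff[OF k p, of q] by auto
    qed
    then have "{p \<in> space (borel_cube K). F_ER K k p < a} =
        (\<Union>q\<in>\<rat> \<inter> {0<..<a}. {p \<in> space (borel_cube K). q \<in> ER_level_set K k p})"
      by (auto simp: space_borel_cube)
    also have "\<dots> \<in> sets (borel_cube K)"
      using level by (intro sets.countable_UN'') (auto intro: countable_subset[OF _ countable_rat])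
    finally show ?thesis .
  next
    case False
    then have "{p \<in> space (borel_cube K). F_ER K k p < a} = space (borel_cube K)"
      using F_ER_range[OF k] by (force simp: space_borel_cube)
    then show ?thesis by simp
  qed
qed

section \<open>Exchangeability and the maximal inequality\<close>

text \<open>Equality of laws, tested against \<open>h\<close>. The restriction to
  \<open>{1..K}\<close> keeps the permuted vector extensional, hence a point of the cube.\<close>

lemma nn_integral_exchangeable:
  assumes P: "P \<in> measurable M (borel_cube K)" and exch: "exchangeable M K P"
    and \<pi>: "\<pi> permutes {1..K}" and h: "h \<in> borel_measurable (borel_cube K)"
  shows "(\<integral>\<^sup>+\<omega>. h (\<lambda>i\<in>{1..K}. P \<omega> (\<pi> i)) \<partial>M) = (\<integral>\<^sup>+\<omega>. h (P \<omega>) \<partial>M)"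
proof -
  have perm: "(\<lambda>\<omega>. \<lambda>i\<in>{1..K}. P \<omega> (\<pi> i)) \<in> measurable M (borel_cube K)"
    unfolding borel_cube_def
  proof (rule measurable_restrict)
    fix i assume "i \<in> {1..K}"
    then have "\<pi> i \<in> {1..K}" using permutes_in_image[OF \<pi>] by blast
    then show "(\<lambda>\<omega>. P \<omega> (\<pi> i)) \<in> measurable M (restrict_space borel {0..1})"
      by (rule measurable_compose[OF P[unfolded borel_cube_def] measurable_component_singleton])
  qed
  have "(\<integral>\<^sup>+\<omega>. h (\<lambda>i\<in>{1..K}. P \<omega> (\<pi> i)) \<partial>M) =
      (\<integral>\<^sup>+p. h p \<partial>distr M (borel_cube K) (\<lambda>\<omega>. \<lambda>i\<in>{1..K}. P \<omega> (\<pi> i)))"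
    using perm h by (simp add: nn_integral_distr)
  also have "\<dots> = (\<integral>\<^sup>+p. h p \<partial>distr M (borel_cube K) P)"
    using exch \<pi> by (simp add: exchangeable_def)
  also have "\<dots> = (\<integral>\<^sup>+\<omega>. h (P \<omega>) \<partial>M)"
    using P h by (simp add: nn_integral_distr)
  finally show ?thesis .
qed

text \<open>Values in \<open>ennreal\<close> admit a \<open>g\<close> that is infinite somewhere, as
  the calibrator is at 0.\<close>

lemma exchangeable_maximal_inequality:
  fixes g :: "real \<Rightarrow> ennreal" and c :: ennreal
  assumes P[measurable]: "P \<in> measurable M (borel_cube K)" and exch: "exchangeable M K P"
    and g[measurable]: "g \<in> borel_measurable borel"
  shows "c * emeasure M {\<omega> \<in> space M. \<exists>l\<in>{1..K}. of_nat l * c \<le> (\<Sum>i=1..l. g (P \<omega> i))}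
    \<le> (\<integral>\<^sup>+\<omega>. g (P \<omega> 1) \<partial>M)"
proof -
  define S where "S l p = (\<Sum>i=1..l. g (p i))" for l and p :: "nat \<Rightarrow> real"
  define cross where "cross l p \<longleftrightarrow> of_nat l * c \<le> S l p" for l p
  \<comment> \<open>The last crossing is used because the event of a first crossing at
    \<open>l\<close> would involve the earlier partial sums, which are not symmetric in the first
    \<open>l\<close> components.\<close>
  define A where "A l = {p \<in> space (borel_cube K). cross l p \<and> (\<forall>m\<in>{l<..K}. \<not> cross m p)}" for l
  have S_meas: "S l \<in> borel_measurable (borel_cube K)" if "l \<in> {1..K}" for l
    unfolding S_def[abs_def]
    using that by (intro borel_measurable_sum measurable_compose[OF borel_cube_component g]) auto
  have A_sets: "A l \<in> sets (borel_cube K)" if "l \<in> {1..K}" for l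
  proof -
    have [measurable]: "Measurable.pred (borel_cube K) (cross m)" if "m \<in> {1..K}" for m
      unfolding cross_def[abs_def] using S_meas[OF that] by measurable
    have "Measurable.pred (borel_cube K) (\<lambda>p. \<forall>m\<in>{l<..K}. \<not> cross m p)"
      using that by (intro pred_intros_finite) auto
    with that show ?thesis unfolding A_def by measurable
  qed
  define E where "E l = (\<integral>\<^sup>+\<omega>. g (P \<omega> 1) * indicator (A l) (P \<omega>) \<partial>M)" for l
  have g_comp [measurable]: "(\<lambda>\<omega>. g (P \<omega> i)) \<in> borel_measurable M" if "i \<in> {1..K}" for i
    using that by (intro measurable_compose[OF measurable_compose[OF P borel_cube_component] g])
  have ind [measurable]: "(\<lambda>\<omega>. indicator (A l) (P \<omega>) :: ennreal) \<in> borel_measurable M"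
    if "l \<in> {1..K}" for l
    using A_sets[OF that] by measurable
  have swap: "(\<integral>\<^sup>+\<omega>. g (P \<omega> i) * indicator (A l) (P \<omega>) \<partial>M) = E l"
    if l: "l \<in> {1..K}" and i: "i \<in> {1..l}" for i l
  proof -
    \<comment> \<open>This transposition moves indices only within \<open>{1..l}\<close>, so it
      fixes every partial sum of length \<open>m \<ge> l\<close>, and it sends \<open>i\<close> to
      1.\<close>
    define \<pi> where "\<pi> = Transposition.transpose 1 i"
    have \<pi>: "\<pi> permutes {1..m}" if "m \<ge> l" for m
      unfolding \<pi>_def using that i by (intro permutes_swap_id) auto
    have S_perm: "S m (\<lambda>j\<in>{1..K}. p (\<pi> j)) = S m p" if "m \<in> {l..K}" for m p
    proof -
      have "S m (\<lambda>j\<in>{1..K}. p (\<pi> j)) = (\<Sum>j=1..m. g (p (\<pi> j)))"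
        unfolding S_def using that by (intro sum.cong) auto
      also have "\<dots> = S m p"
        unfolding S_def using sum.permute[OF \<pi>, of m "\<lambda>j. g (p j)"] that by (simp add: o_def)
      finally show ?thesis .
    qed
    have A_perm: "(\<lambda>j\<in>{1..K}. p (\<pi> j)) \<in> A l \<longleftrightarrow> p \<in> A l" if p: "p \<in> unit_cube K" for p
    proof -
      have "(\<lambda>j\<in>{1..K}. p (\<pi> j)) \<in> unit_cube K"
        using p permutes_in_image[OF \<pi>, of K] l by (auto simp: unit_cube_def PiE_iff)
      moreover have "cross m (\<lambda>j\<in>{1..K}. p (\<pi> j)) \<longleftrightarrow> cross m p" if "m \<in> {l..K}" for m
        unfolding cross_def S_perm[OF that] ..
      ultimately show ?thesis
        using p l unfolding A_def space_borel_cube by fastforce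
    qed
    have "(\<integral>\<^sup>+\<omega>. g (P \<omega> i) * indicator (A l) (P \<omega>) \<partial>M) =
        (\<integral>\<^sup>+\<omega>. g ((\<lambda>j\<in>{1..K}. P \<omega> (\<pi> j)) i) * indicator (A l) (\<lambda>j\<in>{1..K}. P \<omega> (\<pi> j)) \<partial>M)"
    proof (rule nn_integral_exchangeable[OF P exch \<pi>, symmetric])
      show "l \<le> K" using l by simp
      have [measurable]: "(\<lambda>p. p i) \<in> borel_measurable (borel_cube K)" "A l \<in> sets (borel_cube K)"
        using l i A_sets by auto
      show "(\<lambda>p. g (p i) * indicator (A l) p) \<in> borel_measurable (borel_cube K)" by measurable
    qed
    also have "\<dots> = E l"
      unfolding E_def
    proof (intro nn_integral_cong)
      fix \<omega> assume "\<omega> \<in> space M"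
      then have "P \<omega> \<in> unit_cube K" using measurable_space[OF P] by (simp add: space_borel_cube)
      moreover have "(\<lambda>j\<in>{1..K}. P \<omega> (\<pi> j)) i = P \<omega> 1" using l i by (simp add: \<pi>_def)
      ultimately show "g ((\<lambda>j\<in>{1..K}. P \<omega> (\<pi> j)) i) * indicator (A l) (\<lambda>j\<in>{1..K}. P \<omega> (\<pi> j)) =
          g (P \<omega> 1) * indicator (A l) (P \<omega>)"
        using A_perm by (simp add: indicator_def)
    qed
    finally show ?thesis .
  qed
  have level: "c * emeasure M (P -` A l \<inter> space M) \<le> E l" if l: "l \<in> {1..K}" for l
  proof -
    \<comment> \<open>Both sides are scaled by \<open>l\<close>: on \<open>A l\<close> the crossing
      bounds l c by the whole partial sum, whose \<open>l\<close> terms all contribute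
      \<open>E l\<close>. The finite nonzero factor is cancelled at the end.\<close>
    have "of_nat l * (c * emeasure M (P -` A l \<inter> space M)) =
        (\<integral>\<^sup>+\<omega>. of_nat l * c * indicator (A l) (P \<omega>) \<partial>M)"
    proof -
      have "P -` A l \<inter> space M \<in> sets M" using P A_sets[OF l] by (rule measurable_sets)
      then have "of_nat l * c * emeasure M (P -` A l \<inter> space M) =
          (\<integral>\<^sup>+\<omega>. of_nat l * c * indicator (P -` A l \<inter> space M) \<omega> \<partial>M)"
        by (simp add: nn_integral_cmult_indicator)
      also have "\<dots> = (\<integral>\<^sup>+\<omega>. of_nat l * c * indicator (A l) (P \<omega>) \<partial>M)"
        by (intro nn_integral_cong) (auto simp: indicator_def)
      finally show ?thesis by (simp add: mult.assoc)
    qed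
    also have "\<dots> \<le> (\<integral>\<^sup>+\<omega>. (\<Sum>i=1..l. g (P \<omega> i) * indicator (A l) (P \<omega>)) \<partial>M)"
      by (intro nn_integral_mono)
         (auto simp: indicator_def A_def cross_def S_def)
    also have "\<dots> = (\<Sum>i=1..l. \<integral>\<^sup>+\<omega>. g (P \<omega> i) * indicator (A l) (P \<omega>) \<partial>M)"
      using l by (intro nn_integral_sum borel_measurable_times_ennreal g_comp ind) auto
    also have "\<dots> = of_nat l * E l"
      using swap[OF l] by simp
    finally show ?thesis
      using l by (subst (asm) ennreal_mult_le_mult_iff) auto
  qed
  have disj: "disjoint_family_on (\<lambda>l. P -` A l \<inter> space M) {1..K}"
  proof -
    \<comment> \<open>For \<open>l < m\<close>, membership in \<open>A m\<close> requires a crossing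
      at \<open>m\<close>, which membership in \<open>A l\<close> forbids.\<close>
    have "A l \<inter> A m = {}" if "l \<in> {1..K}" "m \<in> {1..K}" "l < m" for l m
      using that by (auto simp: A_def)
    then have "A l \<inter> A m = {}" if "l \<in> {1..K}" "m \<in> {1..K}" "l \<noteq> m" for l m
      using that by (metis Int_commute linorder_neqE_nat)
    then show ?thesis unfolding disjoint_family_on_def by blast
  qed
  have ex_last: "(\<exists>l\<in>{1..K}. cross l p) \<longleftrightarrow> (\<exists>l\<in>{1..K}. p \<in> A l)"
    if p: "p \<in> unit_cube K" for p
  proof
    assume "\<exists>l\<in>{1..K}. cross l p"
    then have ne: "{l\<in>{1..K}. cross l p} \<noteq> {}" by auto
    define n where "n = Max {l\<in>{1..K}. cross l p}"
    have n: "n \<in> {l\<in>{1..K}. cross l p}" unfolding n_def using ne by (intro Max_in) auto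
    have "\<not> cross m p" if m: "m \<in> {n<..K}" for m
    proof
      assume "cross m p"
      then have "m \<le> n" unfolding n_def using m n by (intro Max_ge) auto
      with m show False by simp
    qed
    then show "\<exists>l\<in>{1..K}. p \<in> A l"
      using p n by (intro bexI[of _ n]) (auto simp: A_def space_borel_cube)
  qed (auto simp: A_def)
  have "{\<omega> \<in> space M. \<exists>l\<in>{1..K}. of_nat l * c \<le> (\<Sum>i=1..l. g (P \<omega> i))} =
      (\<Union>l\<in>{1..K}. P -` A l \<inter> space M)"
  proof (intro set_eqI)
    fix \<omega>
    have "\<omega> \<in> space M \<Longrightarrow> P \<omega> \<in> unit_cube K"
      using measurable_space[OF P] by (simp add: space_borel_cube)
    from ex_last[OF this] show "\<omega> \<in>
        {\<omega> \<in> space M. \<exists>l\<in>{1..K}. of_nat l * c \<le> (\<Sum>i=1..l. g (P \<omega> i))} \<longleftrightarrow>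
        \<omega> \<in> (\<Union>l\<in>{1..K}. P -` A l \<inter> space M)"
      unfolding cross_def S_def by blast
  qed
  then have "c * emeasure M {\<omega> \<in> space M. \<exists>l\<in>{1..K}. of_nat l * c \<le> (\<Sum>i=1..l. g (P \<omega> i))} =
      (\<Sum>l=1..K. c * emeasure M (P -` A l \<inter> space M))"
    using A_sets measurable_sets[OF P] disj
    by (subst sum_distrib_left[symmetric], subst sum_emeasure) auto
  also have "\<dots> \<le> (\<Sum>l=1..K. E l)"
    using level by (intro sum_mono) auto
  also have "\<dots> = (\<integral>\<^sup>+\<omega>. (\<Sum>l=1..K. g (P \<omega> 1) * indicator (A l) (P \<omega>)) \<partial>M)"
    unfolding E_def by (intro nn_integral_sum[symmetric] borel_measurable_times_ennreal g_comp ind) auto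
  also have "\<dots> \<le> (\<integral>\<^sup>+\<omega>. g (P \<omega> 1) \<partial>M)"
  proof (intro nn_integral_mono)
    \<comment> \<open>By disjointness at most one of the indicators is 1, so the summed weights do
      not exceed 1.\<close>
    fix \<omega> assume "\<omega> \<in> space M"
    then have "(\<Sum>l=1..K. indicator (A l) (P \<omega>)) =
        (\<Sum>l=1..K. indicator (P -` A l \<inter> space M) \<omega> :: ennreal)"
      by (intro sum.cong) (auto simp: indicator_def)
    also have "\<dots> = indicator (\<Union>l\<in>{1..K}. P -` A l \<inter> space M) \<omega>"
      using disj by (intro indicator_UN_disjoint[symmetric]) auto
    also have "\<dots> \<le> 1" by (simp add: indicator_def)
    finally show "(\<Sum>l=1..K. g (P \<omega> 1) * indicator (A l) (P \<omega>)) \<le> g (P \<omega> 1)"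
      using mult_left_mono[of _ 1 "g (P \<omega> 1)"] by (simp add: sum_distrib_left[symmetric])
  qed
  finally show ?thesis .
qed

section \<open>Validity under exchangeability\<close>

text \<open>The integral is K/k times the length of (0, \<alpha> k/K], an interval contained in
  [0,1].\<close>

lemma nn_integral_calib_uniform:
  assumes k: "k \<in> {1..K}" and \<alpha>: "0 < \<alpha>" "\<alpha> < 1"
  shows "(\<integral>\<^sup>+x. calib K k (x / \<alpha>) \<partial>uniform_measure lborel {0..1}) = ennreal \<alpha>"
proof -
  let ?t = "\<alpha> * (real k / real K)"
  have t: "?t \<le> 1" using k \<alpha> by (intro mult_le_one) auto
  have "(\<integral>\<^sup>+x. calib K k (x / \<alpha>) \<partial>uniform_measure lborel {0..1}) =
      (\<integral>\<^sup>+x. calib K k (x / \<alpha>) * indicator {0..1} x \<partial>lborel)"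
    by (subst nn_integral_uniform_measure) (auto simp: divide_ennreal_def)
  also have "\<dots> = (\<integral>\<^sup>+x. ennreal (real K / real k) * indicator {0<..?t} x \<partial>lborel)"
  \<comment> \<open>The infinite value at 0 sits on a Lebesgue null set and is discarded.\<close>
  proof (rule nn_integral_cong_AE, use AE_lborel_singleton[of "0::real"] in eventually_elim)
    fix x :: real assume "x \<noteq> 0"
    moreover have "x / \<alpha> \<le> real k / real K \<longleftrightarrow> x \<le> ?t"
      using \<alpha> by (auto simp: pos_divide_le_eq mult.commute)
    ultimately show "calib K k (x / \<alpha>) * indicator {0..1} x =
        ennreal (real K / real k) * indicator {0<..?t} x"
      using \<alpha> t by (auto simp: calib_def indicator_def zero_less_divide_iff)
  qed
  also have "\<dots> = ennreal (real K / real k) * ennreal ?t"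
    using \<alpha> by (simp add: nn_integral_cmult_indicator)
  also have "\<dots> = ennreal \<alpha>"
    using k \<alpha> by (simp add: ennreal_mult[symmetric])
  finally show ?thesis .
qed

lemma F_ER_valid:
  assumes M: "prob_space M" and k: "k \<in> {1..K}"
    and P: "P \<in> uniform_vectors M K" and exch: "exchangeable M K P" and \<alpha>: "\<alpha> \<in> {0<..<1}"
  shows "measure M {\<omega> \<in> space M. F_ER K k (P \<omega>) \<le> \<alpha>} \<le> \<alpha>"
proof -
  interpret prob_space M by fact
  have meas: "P \<in> measurable M (borel_cube K)"
    and unif: "distr M borel (\<lambda>\<omega>. P \<omega> 1) = uniform_measure lborel {0..1}"
    using P k by (auto simp: uniform_vectors_def)
  have g [measurable]: "(\<lambda>x. calib K k (x / \<alpha>)) \<in> borel_measurable borel" by measurable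
  have "F_ER K k (P \<omega>) \<le> \<alpha> \<longleftrightarrow>
      (\<exists>l\<in>{1..K}. of_nat l * 1 \<le> (\<Sum>i=1..l. calib K k (P \<omega> i / \<alpha>)))" if "\<omega> \<in> space M" for \<omega>
  proof -
    have "P \<omega> \<in> unit_cube K" using that measurable_space[OF meas] by (simp add: space_borel_cube)
    then show ?thesis using k \<alpha> by (simp add: F_ER_le_iff mem_ER_level_set_iff)
  qed
  \<comment> \<open>The factors 1 are kept to match the maximal inequality with c = 1 and g the
    calibrator rescaled by \<alpha>.\<close>
  then have "emeasure M {\<omega> \<in> space M. F_ER K k (P \<omega>) \<le> \<alpha>} =
      1 * emeasure M {\<omega> \<in> space M. \<exists>l\<in>{1..K}. of_nat l * 1 \<le> (\<Sum>i=1..l. calib K k (P \<omega> i / \<alpha>))}"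
    by (auto intro!: arg_cong[where f = "emeasure M"])
  also have "\<dots> \<le> (\<integral>\<^sup>+\<omega>. calib K k (P \<omega> 1 / \<alpha>) \<partial>M)"
    by (rule exchangeable_maximal_inequality[OF meas exch g])
  also have "\<dots> = (\<integral>\<^sup>+x. calib K k (x / \<alpha>) \<partial>distr M borel (\<lambda>\<omega>. P \<omega> 1))"
    using k by (intro nn_integral_distr[symmetric] measurable_compose[OF meas borel_cube_component]) auto
  also have "\<dots> = ennreal \<alpha>"
    unfolding unif using nn_integral_calib_uniform[OF k] \<alpha> by simp
  finally show ?thesis using \<alpha> by (simp add: emeasure_eq_measure)
qed

section \<open>Strict domination\<close>

text \<open>For \<open>l = K\<close> the rank is exactly \<open>k\<close>, so the k-th order
  statistic of the full vector competes in the minimum. Nonnegativity of \<open>F_R\<close> handles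
  vectors with a zero component, where \<open>F_ER\<close> is 0.\<close>

lemma F_ER_le_F_R:
  assumes k: "k \<in> {1..K}" and p: "p \<in> unit_cube K"
  shows "F_ER K k p \<le> F_R K k p"
proof -
  have "Min ((\<lambda>l. order_stat p l (nat \<lceil>real l * (real k / real K)\<rceil>)) ` {1..K}) \<le> order_stat p K k"
    using k by (intro Min_le image_eqI[of _ _ K]) auto
  then have le: "ER_threshold K k p \<le> F_R K k p"
    unfolding ER_threshold_def F_R_def by (intro mult_left_mono) auto
  have "\<not> order_stat p K k \<le> x" if "x < 0" for x
  proof -
    have "{i\<in>{1..K}. p i \<le> x} = {}"
      using p that by (force simp: unit_cube_def PiE_iff)
    then have "card {i\<in>{1..K}. p i \<le> x} = 0" by (simp only: card.empty)
    moreover have "\<not> k \<le> 0" "1 \<le> k" "k \<le> K" using k by auto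
    ultimately show ?thesis by (simp only: order_stat_le_iff) simp
  qed
  \<comment> \<open>Instantiating the bound with the order statistic itself excludes a negative
    value.\<close>
  from this[of "order_stat p K k"] have "0 \<le> order_stat p K k" by linarith
  then have "0 \<le> F_R K k p" by (simp add: F_R_def)
  with le show ?thesis by (auto simp: F_ER_eq[OF k p] min_le_iff_disj)
qed

lemma strictly_dominates_F_ER_F_R:
  assumes k: "k \<in> {1..K}" and K: "K \<ge> 2"
  shows "strictly_dominates K (F_ER K k) (F_R K k)"
proof -
  have "\<exists>p\<in>unit_cube K. F_ER K k p < F_R K k p"
  proof (cases "k = 1")
    case True
    \<comment> \<open>At the all-ones vector \<open>F_R\<close> is at least K, hence above 1,
      whereas \<open>F_ER\<close> stays in [0,1].\<close>
    let ?p = "\<lambda>i\<in>{1..K}. 1 :: real"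
    have p: "?p \<in> unit_cube K" by (auto simp: unit_cube_def)
    have "\<not> order_stat ?p K k \<le> x" if "x < 1" for x
    proof -
      have "{i\<in>{1..K}. ?p i \<le> x} = {}" using that by auto
      then have "card {i\<in>{1..K}. ?p i \<le> x} = 0" by (simp only: card.empty)
      moreover have "\<not> k \<le> 0" "1 \<le> k" "k \<le> K" using k by auto
      ultimately show ?thesis by (simp only: order_stat_le_iff) simp
    qed
    from this[of "order_stat ?p K k"] have "1 \<le> order_stat ?p K k" by linarith
    then have "real K * 1 \<le> real K * order_stat ?p K k" by (intro mult_left_mono) auto
    moreover have "F_R K k ?p = real K * order_stat ?p K k" using True by (simp add: F_R_def)
    ultimately have "1 < F_R K k ?p" using K by linarith
    with F_ER_range[OF k p] p show ?thesis by (intro bexI[of _ ?p]) auto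
  next
    case False
    \<comment> \<open>A single zero component forces \<open>F_ER\<close> to 0, but since
      \<open>k \<ge> 2\<close> the k-th smallest component is still positive.\<close>
    let ?p = "\<lambda>i\<in>{1..K}. of_bool (i \<noteq> 1) :: real"
    have p: "?p \<in> unit_cube K" by (auto simp: unit_cube_def)
    have "{i\<in>{1..K}. ?p i \<le> 0} = {1}" using K by auto
    then have "0 < order_stat ?p K k" using k False by (subst order_stat_pos_iff) auto
    then have "0 < F_R K k ?p" using k by (simp add: F_R_def)
    moreover have "F_ER K k ?p = 0"
      using K by (subst F_ER_def, subst (1 2) ER_level_set_of_zero[of 1]) auto
    ultimately show ?thesis using p by (intro bexI[of _ ?p]) auto
  qed
  then show ?thesis using F_ER_le_F_R[OF k] by (auto simp: strictly_dominates_def)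
qed

theorem theorem4p1:
  fixes M :: "'a measure" and K k :: nat
  assumes "prob_space M" and "atomless M"
    and "K \<ge> 2" and "k \<in> {1..K}"
  shows "(\<forall>p\<in>unit_cube K. F_ER K k p =
            min 1 ((real K / real k *
                     Min ((\<lambda>l. order_stat p l (nat \<lceil>real l * (real k / real K)\<rceil>)) ` {1..K})) *
                   of_bool (order_stat p K 1 > 0)))
         \<and> ex_p_merging M K (F_ER K k)
         \<and> strictly_dominates K (F_ER K k) (F_R K k)"
proof (intro conjI)
  note k = \<open>k \<in> {1..K}\<close>
  show "\<forall>p\<in>unit_cube K. F_ER K k p =
      min 1 ((real K / real k *
               Min ((\<lambda>l. order_stat p l (nat \<lceil>real l * (real k / real K)\<rceil>)) ` {1..K})) *
             of_bool (order_stat p K 1 > 0))"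
    using F_ER_eq[OF k] unfolding ER_threshold_def by blast
  show "ex_p_merging M K (F_ER K k)"
    unfolding ex_p_merging_def
    using F_ER_range[OF k] F_ER_mono[OF k] F_ER_measurable[OF k] F_ER_valid[OF assms(1) k]
    by blast
  show "strictly_dominates K (F_ER K k) (F_R K k)"
    by (rule strictly_dominates_F_ER_F_R[OF k \<open>K \<ge> 2\<close>])
qed

end
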